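(* Let $T$ be a canonical $\lambda_\epsilon$-term and $\tau$ a type with $\vdash T:\tau$ (empty context). Then either $T$ is a canonical value, i.e. $T=\epsilon^{k_1}(\lambda x_1.t_1)+(\cdots+\epsilon^{k_n}(\lambda x_n.t_n))$ for some $n\ge0$ ($n=0$ meaning $T=0$), or there is a term $t'$ with $T\to t'$.
   Context: Unrestricted terms: $t ::= x \mid \lambda x.t \mid (s\ t) \mid \mathsf{D}(s)\cdot t \mid \epsilon t \mid s+t \mid 0$, up to $\alpha$-equivalence; $\epsilon^k t$ is $k$-fold $\epsilon$ ($\epsilon^0 t=t$). Canonical terms: basic terms $s^b,t^b ::= x \mid \lambda x.t^b \mid (s^b\ t^* ) \mid \mathsf{D}(s^b)\cdot t^b$; positive terms $s^+ ::= s^b\mid s^b+(t^+)$; additive terms $t^*::=0\mid s^+$; positive canonical $S^+::=\epsilon^k s^b\mid \epsilon^k s^b+(S^+)$; canonical $S::=0\mid S^+$. $t[s/x]$ is capture-avoiding substitution. Differential substitution $\frac{\partial t}{\partial x}(s)$ (for $x$ not free in $s$): $\frac{\partial x}{\partial x}(s)=s$; $\frac{\partial y}{\partial x}(s)=0$ ($y\ne x$); $\frac{\partial(\lambda y.t)}{\partial x}(s)=\lambda y.\frac{\partial t}{\partial x}(s)$; $\frac{\partial(t\ e)}{\partial x}(s)=\big((\mathsf{D}(t)\cdot\frac{\partial e}{\partial x}(s))\ e\big)+\big(\frac{\partial t}{\partial x}(s)\ (e[x+\epsilon s/x])\big)$; $\frac{\partial(\mathsf{D}(t)\cdot e)}{\partial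 x}(s)=\mathsf{D}(t)\cdot\frac{\partial e}{\partial x}(s)+\mathsf{D}(\frac{\partial t}{\partial x}(s))\cdot(e[x+\epsilon s/x])+\epsilon\big(\mathsf{D}(\mathsf{D}(t)\cdot e)\cdot\frac{\partial e}{\partial x}(s)\big)$; $\frac{\partial(\epsilon t)}{\partial x}(s)=\epsilon\frac{\partial t}{\partial x}(s)$; $\frac{\partial(t+e)}{\partial x}(s)=\frac{\partial t}{\partial x}(s)+\frac{\partial e}{\partial x}(s)$; $\frac{\partial 0}{\partial x}(s)=0$. One-step reduction $\to$ is the closure under term contexts of $(\lambda x.t)\ s\to t[s/x]$ and $\mathsf{D}(\lambda x.t)\cdot s\to\lambda x.\frac{\partial t}{\partial x}(s)$. Types: $\sigma,\tau ::= \mathbf{t}\mid\sigma\Rightarrow\tau$. Typing rules: $\Gamma\vdash x:\tau$ if $x:\tau$ occurs in $\Gamma$; from $\Gamma\vdash s:\tau\Rightarrow\sigma$ and $\Gamma\vdash t:\tau$ infer $\Gamma\vdash(s\ t):\sigma$ and $\Gamma\vdash\mathsf{D}(s)\cdot t:\tau\Rightarrow\sigma$; from $\Gamma,x:\tau\vdash t:\sigma$ infer $\Gamma\vdash\lambda x.t:\tau\Rightarrow\sigma$; $\Gamma\vdash 0:\tau$ for every $\tau$; from $\Gamma\vdash s:\tau$, $\Gamma\vdash t:\tau$ infer $\Gamma\vdash s+t:\tau$; from $\Gamma\vdash t:\tau$ infer $\Gamma\vdash\epsilon t:\tau$. *)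

theory Defs
  imports Main
begin

text \<open>
  Terms up to alpha-equivalence, in de Bruijn representation: index 0 refers to the innermost
  enclosing abstraction.  The bound variable of an abstraction is thus index 0 of its body.
\<close>

datatype trm =
    Var nat
  | Lam trm
  | App trm trm
  | Diff trm trm  \<comment> \<open>the term \<open>D(s) \<cdot> t\<close>\<close>
  | Eps trm
  | Add trm trm
  | Zero

abbreviation eps_pow :: "nat \<Rightarrow> trm \<Rightarrow> trm" where
  "eps_pow k \<equiv> Eps ^^ k"

primrec rename :: "(nat \<Rightarrow> nat) \<Rightarrow> trm \<Rightarrow> trm" where
  "rename r (Var i) = Var (r i)"
| "rename r (Lam t) = Lam (rename (case_nat 0 (\<lambda>i. Suc (r i))) t)"
| "rename r (App s t) = App (rename r s) (rename r t)"
| "rename r (Diff s t) = Diff (rename r s) (rename r t)"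
| "rename r (Eps t) = Eps (rename r t)"
| "rename r (Add s t) = Add (rename r s) (rename r t)"
| "rename r Zero = Zero"

abbreviation lift :: "trm \<Rightarrow> trm" where
  "lift \<equiv> rename Suc"

text \<open>
  Capture-avoiding simultaneous substitution.  The substitution \<open>t[s/x]\<close>, for \<open>x\<close> the free
  variable with index \<open>x\<close>, is \<open>subst (Var(x := s)) t\<close>; \<open>s\<close> may itself mention \<open>x\<close>.
\<close>

primrec subst :: "(nat \<Rightarrow> trm) \<Rightarrow> trm \<Rightarrow> trm" where
  "subst \<theta> (Var i) = \<theta> i"
| "subst \<theta> (Lam t) = Lam (subst (case_nat (Var 0) (\<lambda>i. lift (\<theta> i))) t)"
| "subst \<theta> (App s t) = App (subst \<theta> s) (subst \<theta> t)"
| "subst \<theta> (Diff s t) = Diff (subst \<theta> s) (subst \<theta> t)"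
| "subst \<theta> (Eps t) = Eps (subst \<theta> t)"
| "subst \<theta> (Add s t) = Add (subst \<theta> s) (subst \<theta> t)"
| "subst \<theta> Zero = Zero"

text \<open>
  Differential substitution: \<open>dsubst t x s\<close> is \<open>\<partial>t/\<partial>x (s)\<close>, meant for \<open>x\<close> not free in \<open>s\<close>.
  The variable \<open>x\<close> may remain free in the result, so no index is removed.
\<close>

primrec dsubst :: "trm \<Rightarrow> nat \<Rightarrow> trm \<Rightarrow> trm" where
  "dsubst (Var y) x s = (if y = x then s else Zero)"
| "dsubst (Lam t) x s = Lam (dsubst t (Suc x) (lift s))"
| "dsubst (App t e) x s =
     Add (App (Diff t (dsubst e x s)) e)
         (App (dsubst t x s) (subst (Var(x := Add (Var x) (Eps s))) e))"
| "dsubst (Diff t e) x s =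
     Add (Add (Diff t (dsubst e x s))
              (Diff (dsubst t x s) (subst (Var(x := Add (Var x) (Eps s))) e)))
         (Eps (Diff (Diff t e) (dsubst e x s)))"
| "dsubst (Eps t) x s = Eps (dsubst t x s)"
| "dsubst (Add t e) x s = Add (dsubst t x s) (dsubst e x s)"
| "dsubst Zero x s = Zero"

text \<open>
  In \<open>beta\<close> the abstracted variable is replaced and its binder disappears, so the remaining
  indices move down by one.  In \<open>dbeta\<close> the binder stays, and \<open>s\<close> moves below it; since
  index 0 is not free in \<open>lift s\<close>, the side condition of differential substitution holds.
\<close>

inductive red :: "trm \<Rightarrow> trm \<Rightarrow> bool" (infix "\<rightarrow>\<^sub>\<epsilon>" 50) where
  beta: "App (Lam t) s \<rightarrow>\<^sub>\<epsilon> subst (case_nat s Var) t"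
| dbeta: "Diff (Lam t) s \<rightarrow>\<^sub>\<epsilon> Lam (dsubst t 0 (lift s))"
| lam: "t \<rightarrow>\<^sub>\<epsilon> t' \<Longrightarrow> Lam t \<rightarrow>\<^sub>\<epsilon> Lam t'"
| appL: "s \<rightarrow>\<^sub>\<epsilon> s' \<Longrightarrow> App s t \<rightarrow>\<^sub>\<epsilon> App s' t"
| appR: "t \<rightarrow>\<^sub>\<epsilon> t' \<Longrightarrow> App s t \<rightarrow>\<^sub>\<epsilon> App s t'"
| diffL: "s \<rightarrow>\<^sub>\<epsilon> s' \<Longrightarrow> Diff s t \<rightarrow>\<^sub>\<epsilon> Diff s' t"
| diffR: "t \<rightarrow>\<^sub>\<epsilon> t' \<Longrightarrow> Diff s t \<rightarrow>\<^sub>\<epsilon> Diff s t'"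
| eps: "t \<rightarrow>\<^sub>\<epsilon> t' \<Longrightarrow> Eps t \<rightarrow>\<^sub>\<epsilon> Eps t'"
| addL: "s \<rightarrow>\<^sub>\<epsilon> s' \<Longrightarrow> Add s t \<rightarrow>\<^sub>\<epsilon> Add s' t"
| addR: "t \<rightarrow>\<^sub>\<epsilon> t' \<Longrightarrow> Add s t \<rightarrow>\<^sub>\<epsilon> Add s t'"

inductive basic :: "trm \<Rightarrow> bool"
  and positive :: "trm \<Rightarrow> bool"
  and additive :: "trm \<Rightarrow> bool" where
  basic_Var: "basic (Var i)"
| basic_Lam: "basic t \<Longrightarrow> basic (Lam t)"
| basic_App: "basic s \<Longrightarrow> additive t \<Longrightarrow> basic (App s t)"
| basic_Diff: "basic s \<Longrightarrow> basic t \<Longrightarrow> basic (Diff s t)"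
| positive_basic: "basic s \<Longrightarrow> positive s"
| positive_Add: "basic s \<Longrightarrow> positive t \<Longrightarrow> positive (Add s t)"
| additive_Zero: "additive Zero"
| additive_positive: "positive s \<Longrightarrow> additive s"

inductive positive_canonical :: "trm \<Rightarrow> bool" where
  "basic s \<Longrightarrow> positive_canonical (eps_pow k s)"
| "basic s \<Longrightarrow> positive_canonical S \<Longrightarrow> positive_canonical (Add (eps_pow k s) S)"

definition canonical :: "trm \<Rightarrow> bool" where
  "canonical S \<longleftrightarrow> S = Zero \<or> positive_canonical S"

fun right_sum :: "trm list \<Rightarrow> trm" where
  "right_sum [] = Zero"
| "right_sum [t] = t"
| "right_sum (t # u # us) = Add t (right_sum (u # us))"

text \<open>
  The bodies of the abstractions are not constrained beyond \<open>canonical T\<close>, which forces them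
  to be basic.
\<close>

definition canonical_value :: "trm \<Rightarrow> bool" where
  "canonical_value T \<longleftrightarrow>
     canonical T \<and> (\<exists>kts. T = right_sum (map (\<lambda>(k, t). eps_pow k (Lam t)) kts))"

datatype ty = Ground | Fun ty ty (infixr "\<rightarrow>\<^sub>t" 65)

text \<open>
  A context is a list of types; its entry \<open>i\<close> is the type of the variable with index \<open>i\<close>.
\<close>

inductive typing :: "ty list \<Rightarrow> trm \<Rightarrow> ty \<Rightarrow> bool" ("_ \<turnstile> _ : _" [50, 50, 50] 50) where
  "i < length \<Gamma> \<Longrightarrow> \<Gamma> ! i = \<tau> \<Longrightarrow> \<Gamma> \<turnstile> Var i : \<tau>"
| "\<Gamma> \<turnstile> s : \<tau> \<rightarrow>\<^sub>t \<sigma> \<Longrightarrow> \<Gamma> \<turnstile> t : \<tau> \<Longrightarrow> \<Gamma> \<turnstile> App s t : \<sigma>"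
| "\<Gamma> \<turnstile> s : \<tau> \<rightarrow>\<^sub>t \<sigma> \<Longrightarrow> \<Gamma> \<turnstile> t : \<tau> \<Longrightarrow> \<Gamma> \<turnstile> Diff s t : \<tau> \<rightarrow>\<^sub>t \<sigma>"
| "\<tau> # \<Gamma> \<turnstile> t : \<sigma> \<Longrightarrow> \<Gamma> \<turnstile> Lam t : \<tau> \<rightarrow>\<^sub>t \<sigma>"
| "\<Gamma> \<turnstile> Zero : \<tau>"
| "\<Gamma> \<turnstile> s : \<tau> \<Longrightarrow> \<Gamma> \<turnstile> t : \<tau> \<Longrightarrow> \<Gamma> \<turnstile> Add s t : \<tau>"
| "\<Gamma> \<turnstile> t : \<tau> \<Longrightarrow> \<Gamma> \<turnstile> Eps t : \<tau>"

end

theory Submission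
  imports Defs
begin

text \<open>In a closed typed basic term, the chain of function positions of \<open>App\<close> and
  \<open>Diff\<close> cannot end in a variable, so it ends in an abstraction. If the chain is
  nontrivial, that abstraction heads a redex; otherwise the term itself is an abstraction
  (\<open>basic_progress\<close>). A nonzero canonical term is a sum of \<open>Eps\<close> powers of
  basic terms, and reduction passes through \<open>Eps\<close> and \<open>Add\<close>: either some
  summand reduces or all are abstractions (\<open>positive_canonical_progress\<close>).\<close>

inductive_cases typing_VarE: "\<Gamma> \<turnstile> Var i : \<tau>"
inductive_cases typing_AppE: "\<Gamma> \<turnstile> App s t : \<tau>"
inductive_cases typing_DiffE: "\<Gamma> \<turnstile> Diff s t : \<tau>"
inductive_cases typing_EpsE: "\<Gamma> \<turnstile> Eps t : \<tau>"
inductive_cases typing_AddE: "\<Gamma> \<turnstile> Add s t : \<tau>"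

lemma typing_eps_powD: "\<Gamma> \<turnstile> eps_pow k t : \<tau> \<Longrightarrow> \<Gamma> \<turnstile> t : \<tau>"
  by (induction k) (auto elim: typing_EpsE)

lemma red_eps_pow: "t \<rightarrow>\<^sub>\<epsilon> t' \<Longrightarrow> eps_pow k t \<rightarrow>\<^sub>\<epsilon> eps_pow k t'"
  by (induction k) (auto intro: red.eps)

text \<open>Basicness keeps \<open>Zero\<close>, \<open>Add\<close> and \<open>Eps\<close> out of
  function position, where they could block reduction. The type is generalised because the function
  part of an application has a different type from the whole.\<close>

lemma basic_progress:
  "basic s \<Longrightarrow> [] \<turnstile> s : \<tau> \<Longrightarrow> (\<exists>t. s = Lam t) \<or> (\<exists>s'. s \<rightarrow>\<^sub>\<epsilon> s')"
proof (induction s arbitrary: \<tau>)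
  case (Var i)
  then show ?case by (auto elim: typing_VarE)
next
  case (App s t)
  from App.prems(1) have "basic s" by (auto elim: basic.cases)
  with App.prems(2) App.IH(1) have "(\<exists>u. s = Lam u) \<or> (\<exists>s'. s \<rightarrow>\<^sub>\<epsilon> s')"
    by (blast elim: typing_AppE)
  then show ?case by (blast intro: red.beta red.appL)
next
  case (Diff s t)
  from Diff.prems(1) have "basic s" by (auto elim: basic.cases)
  with Diff.prems(2) Diff.IH(1) have "(\<exists>u. s = Lam u) \<or> (\<exists>s'. s \<rightarrow>\<^sub>\<epsilon> s')"
    by (blast elim: typing_DiffE)
  then show ?case by (blast intro: red.dbeta red.diffL)
\<comment> \<open>A \<open>Lam\<close> is already of the first form; \<open>Eps\<close>,
  \<open>Add\<close> and \<open>Zero\<close> are not basic.\<close>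
qed (auto elim: basic.cases)

text \<open>
  The list must be nonempty for the induction: \<open>Add t Zero\<close> is not a sum of abstractions.
\<close>

lemma positive_canonical_progress:
  assumes "positive_canonical S" and "[] \<turnstile> S : \<tau>"
  shows "(\<exists>kts. kts \<noteq> [] \<and> S = right_sum (map (\<lambda>(k, t). eps_pow k (Lam t)) kts))
    \<or> (\<exists>S'. S \<rightarrow>\<^sub>\<epsilon> S')"
  using assms
proof (induction rule: positive_canonical.induct)
  case (1 s k)
  then consider t where "s = Lam t" | s' where "s \<rightarrow>\<^sub>\<epsilon> s'"
    using basic_progress typing_eps_powD by blast
  then show ?case
  proof cases
    case (1 t)
    then have "eps_pow k s = right_sum (map (\<lambda>(k, t). eps_pow k (Lam t)) [(k, t)])"
      by simp
    then show ?thesis by blast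
  qed (blast intro: red_eps_pow)
next
  case (2 s S k)
  then have "[] \<turnstile> eps_pow k s : \<tau>" and S: "[] \<turnstile> S : \<tau>"
    by (auto elim: typing_AddE)
  with \<open>basic s\<close> consider t where "s = Lam t" | s' where "s \<rightarrow>\<^sub>\<epsilon> s'"
    using basic_progress typing_eps_powD by blast
  then show ?case
  proof cases
    case (1 t)
    \<comment> \<open>The head summand is an abstraction, so the tail decides.\<close>
    from "2.IH"[OF S] show ?thesis
    proof (elim disjE exE conjE)
      fix kts
      assume "kts \<noteq> []" and "S = right_sum (map (\<lambda>(k, t). eps_pow k (Lam t)) kts)"
      with 1 have "Add (eps_pow k s) S
          = right_sum (map (\<lambda>(k, t). eps_pow k (Lam t)) ((k, t) # kts))"
        \<comment> \<open>\<open>right_sum\<close> produces an \<open>Add\<close> only over a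
          nonempty tail, hence the split on \<open>kts\<close>.\<close>
        by (cases kts) simp_all
      then show ?thesis by blast
    qed (blast intro: red.addR)
  qed (blast intro: red.addL red_eps_pow)
qed

theorem mainTheorem14:
  fixes T :: trm and \<tau> :: ty
  assumes "canonical T"
    and "[] \<turnstile> T : \<tau>"
  shows "canonical_value T \<or> (\<exists>t'. T \<rightarrow>\<^sub>\<epsilon> t')"
proof (cases "T = Zero")
  case True
  \<comment> \<open>\<open>Zero\<close> is the value with no summands.\<close>
  then have "T = right_sum (map (\<lambda>(k, t). eps_pow k (Lam t)) [])" by simp
  with assms(1) show ?thesis unfolding canonical_value_def by blast
next
  case False
  with assms(1) have "positive_canonical T" by (simp add: canonical_def)
  from positive_canonical_progress[OF this assms(2)] assms(1) show ?thesis
    unfolding canonical_value_def by blast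
qed

end
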